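(* Consider the $T_{ANB}$ model with $c_1=1.63$, $c_2=2.1$, $l=0.6$, and with parameters $c_3>0$, $k>0$. The equilibrium $E_2$ of the $T_{ANB}$ model is a strictly positive, locally stable equilibrium if and only if $$LS_{ANB}^1>0,\quad LS_{ANB}^2<0,\quad LS_{ANB}^3>0\quad\text{and}\quad LS_{ANB}^4<0,$$ where $LS_{ANB}^1=100\,c_3-47$, $LS_{ANB}^2=100\,c_3-373$, $$\begin{aligned}LS_{ANB}^3={}&300000000\,c_3^4k-15102000000\,c_3^3k-600000000\,c_3^3+196817000000\,c_3^2k+2238000000\,c_3^2\\&-607025944200\,c_3k+85553100000\,c_3+251560953577\,k+256838922600,\end{aligned}$$ $$\begin{aligned}LS_{ANB}^4={}&900000000000000\,c_3^7k^2-41949000000000000\,c_3^6k^2-1800000000000000\,c_3^6k\\&+667715010000000000\,c_3^5k^2+52020000000000000\,c_3^5k-4657740430500000000\,c_3^4k^2\\&+900000000000000\,c_3^5-523900860000000000\,c_3^4k+14725627073035000000\,c_3^3k^2\\&-10071000000000000\,c_3^4+1398076600800000000\,c_3^3k-15544953327461830000\,c_3^2k^2\\&+56313540000000000\,c_3^3+7799709933666000000\,c_3^2k-13291730300598585700\,c_3k^2\\&-23227083000000000\,c_3^2-29520748208318520000\,c_3k+25092830446277361973\,k^2\\&-5485330423251000000\,c_3-2258144963547738600\,k-14615486984757870000.\end{aligned}$$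
   Context: The $T_{ANB}$ model is the 3-dimensional discrete dynamical system with parameters $c_1,c_2,c_3>0$, $k>0$, $l\in[0,1]$ given by $$\begin{aligned}x(t+1)&=(1-l)x(t)+l\left[\sqrt{\tfrac{y(t)+z(t)}{c_1}}-y(t)-z(t)\right],\\ y(t+1)&=\sqrt{\tfrac{x(t)+z(t)}{c_2}}-x(t)-z(t),\\ z(t+1)&=z(t)+kz(t)\left[\tfrac{x(t)+y(t)}{(x(t)+y(t)+z(t))^2}-c_3\right].\end{aligned}$$ Its equilibrium $E_2$ is $$E_2=\left(\frac{2(c_2+c_3-c_1)}{(c_1+c_2+c_3)^2},\frac{2(c_1+c_3-c_2)}{(c_1+c_2+c_3)^2},\frac{2(c_1+c_2-c_3)}{(c_1+c_2+c_3)^2}\right).$$ Convention: an equilibrium is called locally stable if all (complex) eigenvalues of the Jacobian matrix of the iteration map at that equilibrium lie in the open unit disk $|\lambda|<1$ (linearized asymptotic stability, equivalent to the strict Schur-Cohn inequalities for the characteristic polynomial). Only strictly positive equilibria (all three coordinates $>0$) are considered. *)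

theory Defs
  imports "HOL-Analysis.Analysis"
begin

text \<open>
  The state is \<open>(x, y, z) = (v $ 1, v $ 2, v $ 3)\<close>. HOL's total \<open>sqrt\<close> and division also give the
  map a value where the model's formulas are meaningless (negative radicands, zero denominators);
  on a neighbourhood of any point with positive coordinates it is the model's map.
\<close>

definition T_ANB :: "real \<Rightarrow> real \<Rightarrow> real \<Rightarrow> real \<Rightarrow> real \<Rightarrow> real ^ 3 \<Rightarrow> real ^ 3" where
  "T_ANB c1 c2 c3 k l v =
    (let x = v $ 1; y = v $ 2; z = v $ 3 in
      vector
       [(1 - l) * x + l * (sqrt ((y + z) / c1) - y - z),
        sqrt ((x + z) / c2) - x - z,
        z + k * z * ((x + y) / (x + y + z)\<^sup>2 - c3)])"

definition E2 :: "real \<Rightarrow> real \<Rightarrow> real \<Rightarrow> real ^ 3" where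
  "E2 c1 c2 c3 =
    vector
     [2 * (c2 + c3 - c1) / (c1 + c2 + c3)\<^sup>2,
      2 * (c1 + c3 - c2) / (c1 + c2 + c3)\<^sup>2,
      2 * (c1 + c2 - c3) / (c1 + c2 + c3)\<^sup>2]"

definition equilibrium :: "('a \<Rightarrow> 'a) \<Rightarrow> 'a \<Rightarrow> bool" where
  "equilibrium f p \<longleftrightarrow> f p = p"

definition strictly_positive :: "real ^ 'n \<Rightarrow> bool" where
  "strictly_positive p \<longleftrightarrow> (\<forall>i. p $ i > 0)"

definition complex_eigenvalue :: "real ^ 'n ^ 'n \<Rightarrow> complex \<Rightarrow> bool" where
  "complex_eigenvalue A \<mu> \<longleftrightarrow>
    (\<exists>w :: complex ^ 'n. w \<noteq> 0 \<and> map_matrix complex_of_real A *v w = \<mu> *s w)"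

text \<open>
  Differentiability is required explicitly because \<open>jacobian\<close> is an unspecified matrix at points
  where the map is not differentiable.
\<close>

definition locally_stable :: "(real ^ 'n \<Rightarrow> real ^ 'n) \<Rightarrow> real ^ 'n \<Rightarrow> bool" where
  "locally_stable f p \<longleftrightarrow>
    f differentiable (at p) \<and>
    (\<forall>\<mu>. complex_eigenvalue (jacobian f (at p)) \<mu> \<longrightarrow> norm \<mu> < 1)"

definition LS1_ANB :: "real \<Rightarrow> real" where
  "LS1_ANB c3 = 100 * c3 - 47"

definition LS2_ANB :: "real \<Rightarrow> real" where
  "LS2_ANB c3 = 100 * c3 - 373"

definition LS3_ANB :: "real \<Rightarrow> real \<Rightarrow> real" where
  "LS3_ANB c3 k =
    300000000 * c3^4 * k - 15102000000 * c3^3 * k - 600000000 * c3^3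
    + 196817000000 * c3^2 * k + 2238000000 * c3^2
    - 607025944200 * c3 * k + 85553100000 * c3 + 251560953577 * k + 256838922600"

definition LS4_ANB :: "real \<Rightarrow> real \<Rightarrow> real" where
  "LS4_ANB c3 k =
    900000000000000 * c3^7 * k^2 - 41949000000000000 * c3^6 * k^2
    - 1800000000000000 * c3^6 * k
    + 667715010000000000 * c3^5 * k^2 + 52020000000000000 * c3^5 * k
    - 4657740430500000000 * c3^4 * k^2
    + 900000000000000 * c3^5 - 523900860000000000 * c3^4 * k
    + 14725627073035000000 * c3^3 * k^2
    - 10071000000000000 * c3^4 + 1398076600800000000 * c3^3 * k
    - 15544953327461830000 * c3^2 * k^2
    + 56313540000000000 * c3^3 + 7799709933666000000 * c3^2 * k
    - 13291730300598585700 * c3 * k^2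
    - 23227083000000000 * c3^2 - 29520748208318520000 * c3 * k
    + 25092830446277361973 * k^2
    - 5485330423251000000 * c3 - 2258144963547738600 * k - 14615486984757870000"

end

theory Submission
  imports Defs
begin

text \<open>
  The eigenvalues of the Jacobian at \<open>E\<^sub>2\<close> are the roots of a real cubic \<open>\<mu>\<^sup>3 + A \<mu>\<^sup>2 + B \<mu> + C\<close>, which lie
  in the open unit disk iff \<open>1 + A + B + C > 0\<close>, \<open>1 - A + B - C > 0\<close>, \<open>1 - B + A C - C\<^sup>2 > 0\<close> and
  \<open>\<bar>C\<bar> < 1\<close>. The first condition holds whenever \<open>c\<^sub>3 < c\<^sub>1 + c\<^sub>2\<close>; the next two are, up to positive factors,
  \<open>LS\<^sup>3 > 0\<close> and \<open>LS\<^sup>4 < 0\<close>. The last one is implied by the others: on the range of \<open>c\<^sub>3\<close> with \<open>E\<^sub>2\<close> positive,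
  \<open>1 - C > (1 - A + B - C) / 4\<close>, while \<open>C \<le> -1\<close> would force, as \<open>A > -3\<close>,
  \<open>1 - B + A C - C\<^sup>2 < (1 + C) (2 - C + A) \<le> 0\<close>.
\<close>

section \<open>Schur-Cohn criterion for real quadratics and cubics\<close>

lemma quadratic_roots_in_disc:
  fixes u v :: real
  shows "(\<forall>\<mu>::complex. \<mu>^2 + of_real u * \<mu> + of_real v = 0 \<longrightarrow> norm \<mu> < 1)
    \<longleftrightarrow> 1 + u + v > 0 \<and> 1 - u + v > 0 \<and> v < 1" (is "?L \<longleftrightarrow> ?R")
proof (cases "u^2 < 4 * v")
  case True
  \<comment> \<open>With negative discriminant no root is real, so the imaginary part of the
    equation gives \<open>u = - 2 * Re \<mu>\<close>, and the real part then says that the squared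
    modulus is \<open>v\<close>.\<close>
  have norm_root: "(norm \<mu>)^2 = v" if "\<mu>^2 + of_real u * \<mu> + of_real v = 0" for \<mu> :: complex
  proof -
    have re: "(Re \<mu>)^2 - (Im \<mu>)^2 + u * Re \<mu> + v = 0"
      and im: "2 * Re \<mu> * Im \<mu> + u * Im \<mu> = 0"
      using that by (auto simp: complex_eq_iff power2_eq_square algebra_simps)
    have "Im \<mu> \<noteq> 0"
    proof
      assume "Im \<mu> = 0"
      with re have "(2 * Re \<mu> + u)^2 = u^2 - 4 * v"
        by (simp add: power2_eq_square algebra_simps)
      with True show False
        using zero_le_power2[of "2 * Re \<mu> + u"] by linarith
    qed
    moreover have "(2 * Re \<mu> + u) * Im \<mu> = 0"
      using im by (simp add: algebra_simps)
    ultimately have "u = - 2 * Re \<mu>"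
      by simp
    with re have "(Re \<mu>)^2 + (Im \<mu>)^2 = v"
      by (simp add: power2_eq_square)
    then show ?thesis
      by (simp add: cmod_power2)
  qed
  \<comment> \<open>An explicit root: without one, the hypothesis on all roots would be vacuous and
    would not yield \<open>v < 1\<close>.\<close>
  let ?\<mu> = "Complex (- u / 2) (sqrt (4 * v - u^2) / 2)"
  have "?\<mu>^2 + of_real u * ?\<mu> + of_real v = 0"
    using True by (simp add: complex_eq_iff power2_eq_square field_simps)
  \<comment> \<open>Both hold automatically here: \<open>4 * v > u^2\<close> turns
    \<open>(u + 2)^2\<close> and \<open>(u - 2)^2\<close> into strict lower bounds for four times
    these sums.\<close>
  moreover have "1 + u + v > 0 \<and> 1 - u + v > 0"
    using True zero_le_power2[of "u + 2"] zero_le_power2[of "u - 2"]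
    by (simp add: power2_eq_square algebra_simps)
  ultimately show ?thesis
    using norm_root by (metis abs_norm_cancel abs_square_less_1)
next
  case False
  define d where "d = sqrt (u^2 - 4 * v)"
  define x where "x = (- u + d) / 2"
  define y where "y = (- u - d) / 2"
  have "d * d = u^2 - 4 * v"
    using False by (simp add: d_def)
  then have uv: "u = - (x + y)" "v = x * y"
    by (simp_all add: x_def y_def field_simps power2_eq_square)
  have "\<mu>^2 + of_real u * \<mu> + of_real v = (\<mu> - of_real x) * (\<mu> - of_real y)" for \<mu> :: complex
    by (simp add: uv power2_eq_square algebra_simps)
  then have "?L \<longleftrightarrow> \<bar>x\<bar> < 1 \<and> \<bar>y\<bar> < 1"
    by auto
  also have "\<dots> \<longleftrightarrow> ?R"
  proof
    assume xy: "\<bar>x\<bar> < 1 \<and> \<bar>y\<bar> < 1"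
    then have "(1 - x) * (1 - y) > 0" "(1 + x) * (1 + y) > 0"
      by (auto intro!: mult_pos_pos)
    moreover have "\<bar>x\<bar> * \<bar>y\<bar> < 1 * 1"
      using xy by (intro mult_strict_mono') auto
    ultimately show ?R
      by (auto simp: uv algebra_simps abs_mult[symmetric])
  next
    assume ?R
    then have pos: "(1 - x) * (1 - y) > 0" "(1 + x) * (1 + y) > 0" and "x * y < 1"
      by (simp_all add: uv algebra_simps)
    \<comment> \<open>A positive product leaves only the alternative that both factors are negative;
      then \<open>x\<close> and \<open>y\<close> both exceed 1, against \<open>x * y < 1\<close>.
      The bound at -1 is symmetric.\<close>
    have "x < 1"
    proof (rule ccontr)
      assume "\<not> x < 1"
      with pos(1) have "x > 1" "y > 1"
        by (auto simp: zero_less_mult_iff)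
      then have "1 * 1 < x * y" by (intro mult_strict_mono) auto
      with \<open>x * y < 1\<close> show False by simp
    qed
    moreover have "- x < 1"
    proof (rule ccontr)
      assume "\<not> - x < 1"
      with pos(2) have "- x > 1" "- y > 1"
        by (auto simp: zero_less_mult_iff)
      then have "1 * 1 < (- x) * (- y)" by (intro mult_strict_mono) auto
      with \<open>x * y < 1\<close> show False by simp
    qed
    ultimately show "\<bar>x\<bar> < 1 \<and> \<bar>y\<bar> < 1"
      using pos by (auto simp: zero_less_mult_iff)
  qed
  finally show ?thesis .
qed

lemma real_cubic_root:
  fixes a b c :: real
  obtains r where "r^3 + a * r^2 + b * r + c = 0"
proof -
  define f where "f = (\<lambda>x::real. x^3 + a * x^2 + b * x + c)"
  \<comment> \<open>A Cauchy-type bound: since \<open>R \<ge> 1\<close>, the cube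
    \<open>R^3 = R * R^2\<close> dominates the lower-order terms, so the cubic changes sign on
    \<open>{- R..R}\<close>.\<close>
  define R where "R = 1 + \<bar>a\<bar> + \<bar>b\<bar> + \<bar>c\<bar>"
  have "R \<ge> 1" by (simp add: R_def)
  then have R2: "R \<le> R^2" "1 \<le> R^2" by (simp_all add: self_le_power)
  have "\<bar>a * R^2\<bar> \<le> \<bar>a\<bar> * R^2" "\<bar>b * R\<bar> \<le> \<bar>b\<bar> * R^2" "\<bar>c\<bar> \<le> \<bar>c\<bar> * R^2"
    using R2 \<open>R \<ge> 1\<close> by (simp_all add: abs_mult mult_left_mono mult_le_cancel_left1)
  moreover have "R^3 = R^2 + \<bar>a\<bar> * R^2 + \<bar>b\<bar> * R^2 + \<bar>c\<bar> * R^2"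
    by (simp add: power3_eq_cube power2_eq_square R_def algebra_simps)
  moreover have "a * R\<^sup>2 \<le> \<bar>a * R\<^sup>2\<bar>" "- (a * R\<^sup>2) \<le> \<bar>a * R\<^sup>2\<bar>"
    "b * R \<le> \<bar>b * R\<bar>" "- (b * R) \<le> \<bar>b * R\<bar>" "c \<le> \<bar>c\<bar>" "- c \<le> \<bar>c\<bar>"
    by (rule abs_ge_self abs_ge_minus_self)+
  moreover have "f (- R) = - (R^3) + a * R\<^sup>2 - b * R + c" "f R = R^3 + a * R\<^sup>2 + b * R + c"
    by (simp_all add: f_def)
  ultimately have "f (- R) \<le> 0" "0 \<le> f R"
    using R2 by linarith+
  moreover have "continuous_on {- R..R} f"
    unfolding f_def by (intro continuous_intros)
  ultimately obtain r where "f r = 0"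
    using IVT'[of f "- R" 0 R] \<open>R \<ge> 1\<close> by auto
  then show ?thesis
    using that by (auto simp: f_def)
qed

text \<open>Replacing \<open>u\<close> by its upper bound \<open>- (1 + v)\<close> turns the
  quadratic into \<open>(1 - r) * (1 - r * v)\<close>, whose factors have opposite signs. In the
  cubic criterion this excludes a real root outside the disk: the determinant condition would become
  negative.\<close>

lemma exterior_real_root_quadratic_neg:
  fixes r u v :: real
  assumes "r > 1" "1 + u + v < 0" "r * \<bar>v\<bar> < 1"
  shows "\<bar>v\<bar> < 1 \<and> 1 + u * r + v * r^2 < 0"
proof
  show "\<bar>v\<bar> < 1"
    using assms mult_right_mono[of 1 r "\<bar>v\<bar>"] by simp
  have "r * v \<le> r * \<bar>v\<bar>"
    using assms by (intro mult_left_mono) auto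
  with assms have "r * v < 1"
    by linarith
  with assms have "(1 - r) * (1 - r * v) < 0"
    by (simp add: mult_less_0_iff)
  moreover have "u * r \<le> - (1 + v) * r"
    using assms by (intro mult_right_mono) auto
  ultimately show "1 + u * r + v * r^2 < 0"
    by (simp add: algebra_simps power2_eq_square)
qed

text \<open>A real cubic has a real root \<open>r\<close>; dividing it out leaves a real quadratic,
  to which the quadratic criterion applies. It remains to translate the conditions on
  \<open>r\<close>, \<open>u\<close>, \<open>v\<close> into conditions on the coefficients.\<close>

lemma cubic_roots_in_disc:
  fixes a b c :: real
  shows "(\<forall>\<mu>::complex. \<mu>^3 + of_real a * \<mu>^2 + of_real b * \<mu> + of_real c = 0 \<longrightarrow> norm \<mu> < 1)
    \<longleftrightarrow> 1 + a + b + c > 0 \<and> 1 - a + b - c > 0 \<and> 1 - b + a * c - c^2 > 0 \<and> \<bar>c\<bar> < 1"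
    (is "?L \<longleftrightarrow> ?R")
proof -
  obtain r where r: "r^3 + a * r^2 + b * r + c = 0"
    by (rule real_cubic_root)
  define u where "u = a + r"
  define v where "v = b + r * u"
  have abc: "a = u - r" "b = v - r * u" "c = - (r * v)"
    using r by (simp_all add: u_def v_def power2_eq_square power3_eq_cube algebra_simps)
  have "\<mu>^3 + of_real a * \<mu>^2 + of_real b * \<mu> + of_real c
      = (\<mu> - of_real r) * (\<mu>^2 + of_real u * \<mu> + of_real v)" for \<mu> :: complex
    by (simp add: abc power2_eq_square power3_eq_cube algebra_simps)
  then have "?L \<longleftrightarrow> \<bar>r\<bar> < 1 \<and>
      (\<forall>\<mu>::complex. \<mu>^2 + of_real u * \<mu> + of_real v = 0 \<longrightarrow> norm \<mu> < 1)"
    by auto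
  also have "\<dots> \<longleftrightarrow> \<bar>r\<bar> < 1 \<and> 1 + u + v > 0 \<and> 1 - u + v > 0 \<and> v < 1"
    by (simp only: quadratic_roots_in_disc)
  also have "\<dots> \<longleftrightarrow> ?R"
  proof -
    \<comment> \<open>If the quadratic factor has roots x and y, the right-hand side of
      \<open>D\<close> is (1 - x y)(1 - r x)(1 - r y), a product over pairs of roots;
      \<open>P\<close> and \<open>M\<close> are the values of the cubic at 1 and, up to sign, at
      -1.\<close>
    have P: "1 + a + b + c = (1 - r) * (1 + u + v)"
      and M: "1 - a + b - c = (1 + r) * (1 - u + v)"
      and D: "1 - b + a * c - c^2 = (1 - v) * (1 + u * r + v * r^2)"
      by (simp_all add: abc power2_eq_square algebra_simps)
    have c: "\<bar>c\<bar> = \<bar>r\<bar> * \<bar>v\<bar>" by (simp add: abc abs_mult)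
    \<comment> \<open>The two endpoint conditions say \<open>\<bar>u\<bar> < 1 + v\<close>, which
      bounds \<open>u * r\<close> from below by \<open>- (1 + v) * \<bar>r\<bar>\<close>.\<close>
    have key: "(1 - \<bar>r\<bar>) * (1 - v * \<bar>r\<bar>) > 0 \<and> 1 + u * r + v * r^2 \<ge> (1 - \<bar>r\<bar>) * (1 - v * \<bar>r\<bar>)"
      if "\<bar>r\<bar> < 1" "1 + u + v > 0" "1 - u + v > 0" "\<bar>c\<bar> < 1"
    proof
      have "v * \<bar>r\<bar> \<le> \<bar>r\<bar> * \<bar>v\<bar>"
        using mult_left_mono[OF abs_ge_self[of v], of "\<bar>r\<bar>"] by (simp add: mult.commute)
      with that(4) c have "v * \<bar>r\<bar> < 1" by linarith
      then show "(1 - \<bar>r\<bar>) * (1 - v * \<bar>r\<bar>) > 0" using that by simp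
      have "\<bar>u * r\<bar> \<le> (1 + v) * \<bar>r\<bar>"
        using that by (simp add: abs_mult mult_right_mono)
      then show "1 + u * r + v * r^2 \<ge> (1 - \<bar>r\<bar>) * (1 - v * \<bar>r\<bar>)"
        by (simp add: algebra_simps power2_eq_square)
    qed
    show ?thesis
    proof
      assume L: "\<bar>r\<bar> < 1 \<and> 1 + u + v > 0 \<and> 1 - u + v > 0 \<and> v < 1"
      then have "\<bar>v\<bar> < 1" by linarith
      then have "\<bar>c\<bar> < 1"
        using L c mult_strict_mono'[of "\<bar>r\<bar>" 1 "\<bar>v\<bar>" 1] by simp
      with L key P M D show ?R by force
    next
      assume R: ?R
      have "r < 1"
      proof (rule ccontr)
        assume "\<not> r < 1"
        with R P have r: "r > 1" "1 + u + v < 0" by (auto simp: zero_less_mult_iff)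
        moreover have "r * \<bar>v\<bar> < 1" using R c r by simp
        ultimately have "\<bar>v\<bar> < 1 \<and> 1 + u * r + v * r^2 < 0"
          by (rule exterior_real_root_quadratic_neg)
        with R D show False by (auto simp: zero_less_mult_iff)
      qed
      \<comment> \<open>The reflection of the variable sends \<open>r\<close>, \<open>u\<close>,
        \<open>v\<close> to \<open>- r\<close>, \<open>- u\<close>, \<open>v\<close> and exchanges
        \<open>P\<close> with \<open>M\<close>.\<close>
      moreover have "- r < 1"
      proof (rule ccontr)
        assume "\<not> - r < 1"
        with R M have r: "- r > 1" "1 + (- u) + v < 0" by (auto simp: zero_less_mult_iff)
        moreover have "(- r) * \<bar>v\<bar> < 1" using R c r by simp
        ultimately have "\<bar>v\<bar> < 1 \<and> 1 + (- u) * (- r) + v * (- r)^2 < 0"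
          by (rule exterior_real_root_quadratic_neg)
        with R D show False by (auto simp: zero_less_mult_iff)
      qed
      ultimately have "\<bar>r\<bar> < 1" "1 + u + v > 0" "1 - u + v > 0"
        using R P M by (auto simp: zero_less_mult_iff)
      moreover from this R key have "1 + u * r + v * r^2 > 0" by linarith
      ultimately show "\<bar>r\<bar> < 1 \<and> 1 + u + v > 0 \<and> 1 - u + v > 0 \<and> v < 1"
        using R D by (auto simp: zero_less_mult_iff)
    qed
  qed
  finally show ?thesis .
qed

section \<open>Equilibrium, Jacobian and characteristic polynomial at \<open>E2\<close>\<close>

lemma complex_eigenvalue_iff_det:
  "complex_eigenvalue A \<mu> \<longleftrightarrow> det (map_matrix complex_of_real A - mat \<mu>) = 0"
proof -
  let ?B = "map_matrix complex_of_real A - mat \<mu>"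
  have mat: "(mat \<mu> :: complex ^ 'a ^ 'a) *v w = \<mu> *s w" for w
    by (simp add: vec_eq_iff matrix_vector_mult_def mat_def if_distrib[of "\<lambda>x. x * _"] cong: if_cong)
  have "map_matrix complex_of_real A *v w = \<mu> *s w \<longleftrightarrow> ?B *v w = 0" for w
    by (simp add: matrix_vector_mult_diff_rdistrib mat)
  then show ?thesis
    by (metis complex_eigenvalue_def invertible_det_nz invertible_left_inverse matrix_left_invertible_ker)
qed

text \<open>The Jacobian of the map at \<open>E2\<close> in closed form. Here \<open>a\<close> and
  \<open>b\<close> are the slopes of \<open>sqrt (t / c) - t\<close>, for \<open>c\<close> equal to
  \<open>c1\<close> and \<open>c2\<close>, at the point where the root equals \<open>2 / s\<close>;
  \<open>p\<close> is the partial derivative of the third component in x and equally in y, and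
  \<open>q\<close> the one in z.\<close>

definition J_E2 :: "real \<Rightarrow> real \<Rightarrow> real \<Rightarrow> real \<Rightarrow> real \<Rightarrow> real ^ 3 ^ 3" where
  "J_E2 c1 c2 c3 k l =
    (let s = c1 + c2 + c3;
         a = s / (4 * c1) - 1;
         b = s / (4 * c2) - 1;
         p = k * (c1 + c2 - c3) * (1 / 2 - 2 * c3 / s);
         q = 1 - 2 * k * c3 * (c1 + c2 - c3) / s
     in vector [vector [1 - l, l * a, l * a], vector [b, 0, b], vector [p, p, q]])"

text \<open>The map depends on its coordinates mostly through these sums. At \<open>E2\<close> they
  make both radicands equal to the square of the total \<open>2 / s\<close>, and the growth bracket
  of the third component vanish.\<close>

lemma sums_E2:
  fixes c1 c2 c3 :: real
  assumes "c1 + c2 + c3 \<noteq> 0"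
  shows "E2 c1 c2 c3 $ 2 + E2 c1 c2 c3 $ 3 = c1 * (2 / (c1 + c2 + c3))^2"
    and "E2 c1 c2 c3 $ 1 + E2 c1 c2 c3 $ 3 = c2 * (2 / (c1 + c2 + c3))^2"
    and "E2 c1 c2 c3 $ 1 + E2 c1 c2 c3 $ 2 = c3 * (2 / (c1 + c2 + c3))^2"
    and "E2 c1 c2 c3 $ 1 + E2 c1 c2 c3 $ 2 + E2 c1 c2 c3 $ 3 = 2 / (c1 + c2 + c3)"
proof -
  show "E2 c1 c2 c3 $ 2 + E2 c1 c2 c3 $ 3 = c1 * (2 / (c1 + c2 + c3))^2"
    "E2 c1 c2 c3 $ 1 + E2 c1 c2 c3 $ 3 = c2 * (2 / (c1 + c2 + c3))^2"
    "E2 c1 c2 c3 $ 1 + E2 c1 c2 c3 $ 2 = c3 * (2 / (c1 + c2 + c3))^2"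
    by (simp_all add: E2_def power_divide flip: add_divide_distrib)
  have "E2 c1 c2 c3 $ 1 + E2 c1 c2 c3 $ 2 + E2 c1 c2 c3 $ 3
    = 2 * (c1 + c2 + c3) / (c1 + c2 + c3)^2"
    by (simp add: E2_def flip: add_divide_distrib)
  also have "\<dots> = 2 / (c1 + c2 + c3)"
    using assms by (simp only: power2_eq_square nonzero_mult_divide_mult_cancel_right simp_thms)
  finally show "E2 c1 c2 c3 $ 1 + E2 c1 c2 c3 $ 2 + E2 c1 c2 c3 $ 3 = 2 / (c1 + c2 + c3)" .
qed

lemma T_ANB_nth:
  "T_ANB c1 c2 c3 k l v $ 1 = (1 - l) * v $ 1 + l * (sqrt ((v $ 2 + v $ 3) / c1) - (v $ 2 + v $ 3))"
  "T_ANB c1 c2 c3 k l v $ 2 = sqrt ((v $ 1 + v $ 3) / c2) - (v $ 1 + v $ 3)"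
  "T_ANB c1 c2 c3 k l v $ 3
    = v $ 3 + k * v $ 3 * ((v $ 1 + v $ 2) / (v $ 1 + v $ 2 + v $ 3)\<^sup>2 - c3)"
  by (simp_all add: T_ANB_def Let_def)

lemma growth_rate_E2:
  assumes "c1 + c2 + c3 \<noteq> 0"
  shows "(E2 c1 c2 c3 $ 1 + E2 c1 c2 c3 $ 2)
    / (E2 c1 c2 c3 $ 1 + E2 c1 c2 c3 $ 2 + E2 c1 c2 c3 $ 3)\<^sup>2 = c3"
  unfolding sums_E2(4)[OF assms] unfolding sums_E2(3)[OF assms] using assms by simp

lemma equilibrium_E2:
  assumes "c1 > 0" "c2 > 0" "c3 > 0"
  shows "equilibrium (T_ANB c1 c2 c3 k l) (E2 c1 c2 c3)"
proof -
  have s: "c1 + c2 + c3 \<noteq> 0" "2 / (c1 + c2 + c3) > 0" using assms by auto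
  note sums = sums_E2[OF s(1)]
  have "sqrt (c1 * (2 / (c1 + c2 + c3))^2 / c1) = 2 / (c1 + c2 + c3)"
    "sqrt (c2 * (2 / (c1 + c2 + c3))^2 / c2) = 2 / (c1 + c2 + c3)"
    using assms s(2) by (simp_all add: real_sqrt_divide)
  then have root: "sqrt ((E2 c1 c2 c3 $ 2 + E2 c1 c2 c3 $ 3) / c1)
      = E2 c1 c2 c3 $ 1 + E2 c1 c2 c3 $ 2 + E2 c1 c2 c3 $ 3"
    "sqrt ((E2 c1 c2 c3 $ 1 + E2 c1 c2 c3 $ 3) / c2)
      = E2 c1 c2 c3 $ 1 + E2 c1 c2 c3 $ 2 + E2 c1 c2 c3 $ 3"
    by (simp_all only: sums(1,2,4))
  show ?thesis
    by (simp add: equilibrium_def vec_eq_iff forall_3 T_ANB_nth root growth_rate_E2[OF s(1)])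
       (simp add: algebra_simps)
qed

text \<open>Covers the nonlinear parts of the first two components. Writing the value of
  \<open>u\<close> as \<open>c * r^2\<close> makes the root equal to \<open>r\<close>, and
  \<open>r > 0\<close> keeps the radicand away from 0, where \<open>sqrt\<close> is not
  differentiable.\<close>

lemma has_derivative_sqrt_minus:
  fixes u :: "'a::real_normed_vector \<Rightarrow> real"
  assumes u: "(u has_derivative u') (at p)" and p: "u p = c * r^2" and "c > 0" "r > 0"
  shows "((\<lambda>v. sqrt (u v / c) - u v) has_derivative (\<lambda>h. (1 / (2 * c * r) - 1) * u' h)) (at p)"
proof -
  have "u p / c = r^2"
    using p \<open>c > 0\<close> by simp
  moreover have "((\<lambda>t. t / c) has_real_derivative 1 / c) (at (u p))"
    by (rule DERIV_cdivide[OF DERIV_ident])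
  ultimately have "((\<lambda>t. sqrt (t / c)) has_real_derivative inverse r / 2 * (1 / c)) (at (u p))"
    using DERIV_chain2[of sqrt "inverse r / 2" "\<lambda>t. t / c" "u p" "1 / c" UNIV] DERIV_real_sqrt[of "r^2"] \<open>r > 0\<close>
    by simp
  moreover have "inverse r / 2 * (1 / c) = 1 / (2 * c * r)"
    by (simp add: field_simps)
  ultimately have "((\<lambda>t. sqrt (t / c) - t) has_real_derivative 1 / (2 * c * r) - 1) (at (u p))"
    using DERIV_diff[OF _ DERIV_ident] by metis
  from DERIV_compose_FDERIV[OF this u] show ?thesis
    by (simp add: mult.commute)
qed

lemma has_derivative_vec_components:
  fixes f :: "real ^ 'm \<Rightarrow> real ^ 'n"
  assumes "\<And>i. ((\<lambda>x. f x $ i) has_derivative (\<lambda>h. f' h $ i)) (at x)"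
  shows "(f has_derivative f') (at x)"
  using assms by (subst has_derivative_componentwise_within) (auto simp: Basis_vec_def inner_axis)

lemma has_derivative_divide_power2:
  fixes n m :: "'a::real_normed_vector \<Rightarrow> real"
  assumes "(n has_derivative n') (at p)" "(m has_derivative m') (at p)" "m p \<noteq> 0"
  shows "((\<lambda>v. n v / (m v)\<^sup>2) has_derivative
    (\<lambda>h. n' h / (m p)\<^sup>2 - 2 * n p * m' h / (m p)^3)) (at p)"
proof (rule has_derivative_eq_rhs)
  show "((\<lambda>v. n v / (m v)\<^sup>2) has_derivative (\<lambda>h. - n p *
      (inverse ((m p)\<^sup>2) * (of_nat 2 * m' h * m p ^ (2 - 1)) * inverse ((m p)\<^sup>2)) + n' h / (m p)\<^sup>2)) (at p)"
    using assms(3) by (intro has_derivative_divide has_derivative_power assms(1,2)) simp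
  have "- x * (inverse (t\<^sup>2) * (of_nat 2 * y * t ^ (2 - 1)) * inverse (t\<^sup>2)) + z / t\<^sup>2
      = z / t\<^sup>2 - 2 * x * y / t^3" if "t \<noteq> 0" for t x y z :: real
    using that by (simp add: divide_simps power2_eq_square power3_eq_cube)
  then show "(\<lambda>h. - n p * (inverse ((m p)\<^sup>2) * (of_nat 2 * m' h * m p ^ (2 - 1)) * inverse ((m p)\<^sup>2))
      + n' h / (m p)\<^sup>2) = (\<lambda>h. n' h / (m p)\<^sup>2 - 2 * n p * m' h / (m p)^3)"
    using assms(3) by blast
qed

lemma J_E2_mult_nth:
  fixes c1 c2 c3 :: real
  defines "s \<equiv> c1 + c2 + c3"
  shows "(J_E2 c1 c2 c3 k l *v h) $ 1 = (1 - l) * h $ 1 + l * ((s / (4 * c1) - 1) * (h $ 2 + h $ 3))"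
    and "(J_E2 c1 c2 c3 k l *v h) $ 2 = (s / (4 * c2) - 1) * (h $ 1 + h $ 3)"
    and "(J_E2 c1 c2 c3 k l *v h) $ 3 = k * (c1 + c2 - c3) * (1 / 2 - 2 * c3 / s) * (h $ 1 + h $ 2)
      + (1 - 2 * k * c3 * (c1 + c2 - c3) / s) * h $ 3"
  by (simp_all only: J_E2_def Let_def matrix_vector_mult_def sum_3 vector_3 vec_lambda_beta s_def)
     (simp_all only: distrib_left mult.assoc mult_zero_left add_0_right add.assoc)

lemma T_ANB_has_derivative_E2:
  assumes pos: "c1 > 0" "c2 > 0" "c3 > 0"
  shows "(T_ANB c1 c2 c3 k l has_derivative (\<lambda>h. J_E2 c1 c2 c3 k l *v h)) (at (E2 c1 c2 c3))"
proof (rule has_derivative_vec_components)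
  fix i :: 3
  define s where "s = c1 + c2 + c3"
  have "s > 0" using pos by (simp add: s_def)
  let ?e = "E2 c1 c2 c3"
  note sums = sums_E2[of c1 c2 c3, folded s_def]
  have d: "((\<lambda>v. v $ j) has_derivative (\<lambda>h. h $ j)) (at ?e)" for j
    by (rule bounded_linear_imp_has_derivative[OF bounded_linear_vec_nth])
  \<comment> \<open>Brings the slopes into the shape \<open>1 / (2 * c * r)\<close> with
    \<open>r = 2 / s\<close>, the common value of both roots at \<open>E2\<close>.\<close>
  have s: "s / (4 * c1) = 1 / (2 * c1 * (2 / s))" "s / (4 * c2) = 1 / (2 * c2 * (2 / s))"
    by simp_all
  have r1: "((\<lambda>v. sqrt ((v $ 2 + v $ 3) / c1) - (v $ 2 + v $ 3)) has_derivative
      (\<lambda>h. (s / (4 * c1) - 1) * (h $ 2 + h $ 3))) (at ?e)"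
    unfolding s using sums \<open>s > 0\<close> pos
    by (intro has_derivative_sqrt_minus has_derivative_add d) auto
  have r2: "((\<lambda>v. sqrt ((v $ 1 + v $ 3) / c2) - (v $ 1 + v $ 3)) has_derivative
      (\<lambda>h. (s / (4 * c2) - 1) * (h $ 1 + h $ 3))) (at ?e)"
    unfolding s using sums \<open>s > 0\<close> pos
    by (intro has_derivative_sqrt_minus has_derivative_add d) auto
  have r3: "((\<lambda>v. (v $ 1 + v $ 2) / (v $ 1 + v $ 2 + v $ 3)\<^sup>2 - c3) has_derivative
      (\<lambda>h. (s^2 / 4 - c3 * s) * (h $ 1 + h $ 2) - c3 * s * h $ 3)) (at ?e)"
  proof -
    have "((\<lambda>v. (v $ 1 + v $ 2) / (v $ 1 + v $ 2 + v $ 3)\<^sup>2) has_derivative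
      (\<lambda>h. (h $ 1 + h $ 2) / (2 / s)^2 - 2 * (c3 * (2 / s)^2) * (h $ 1 + h $ 2 + h $ 3) / (2 / s)^3)) (at ?e)"
      using has_derivative_divide_power2[of "\<lambda>v. v $ 1 + v $ 2" "\<lambda>h. h $ 1 + h $ 2" ?e
          "\<lambda>v. v $ 1 + v $ 2 + v $ 3" "\<lambda>h. h $ 1 + h $ 2 + h $ 3"] sums \<open>s > 0\<close>
      by (simp add: has_derivative_add d)
    then have "((\<lambda>v. (v $ 1 + v $ 2) / (v $ 1 + v $ 2 + v $ 3)\<^sup>2 - c3) has_derivative
      (\<lambda>h. (h $ 1 + h $ 2) / (2 / s)^2 - 2 * (c3 * (2 / s)^2) * (h $ 1 + h $ 2 + h $ 3) / (2 / s)^3 - 0)) (at ?e)"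
      by (rule has_derivative_diff) (rule has_derivative_const)
    then show ?thesis
      by (rule has_derivative_eq_rhs)
        (use \<open>s > 0\<close> in \<open>simp add: fun_eq_iff power_divide field_simps power2_eq_square power3_eq_cube\<close>)
  qed
  have z: "?e $ 3 = 2 * (c1 + c2 - c3) / s^2" by (simp add: E2_def s_def)
  \<comment> \<open>As the bracket vanishes at the equilibrium, the product rule for the third
    component keeps only the term that differentiates the bracket.\<close>
  have g: "(?e $ 1 + ?e $ 2) / (?e $ 1 + ?e $ 2 + ?e $ 3)\<^sup>2 - c3 = 0"
    using growth_rate_E2[of c1 c2 c3] \<open>s > 0\<close> by (simp add: s_def)
  show "((\<lambda>v. T_ANB c1 c2 c3 k l v $ i) has_derivative (\<lambda>h. (J_E2 c1 c2 c3 k l *v h) $ i)) (at ?e)"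
    using exhaust_3[of i]
  proof (elim disjE)
    assume i: "i = 1"
    show ?thesis
      unfolding i T_ANB_nth J_E2_mult_nth s_def[symmetric]
      by (rule has_derivative_add has_derivative_mult_right r1 d)+
  next
    assume i: "i = 2"
    show ?thesis
      unfolding i T_ANB_nth J_E2_mult_nth s_def[symmetric]
      by (rule r2)
  next
    assume i: "i = 3"
    have "((\<lambda>v. v $ 3 + k * v $ 3 * ((v $ 1 + v $ 2) / (v $ 1 + v $ 2 + v $ 3)\<^sup>2 - c3)) has_derivative
      (\<lambda>h. h $ 3 + (k * ?e $ 3 * ((s^2 / 4 - c3 * s) * (h $ 1 + h $ 2) - c3 * s * h $ 3)
        + k * h $ 3 * ((?e $ 1 + ?e $ 2) / (?e $ 1 + ?e $ 2 + ?e $ 3)\<^sup>2 - c3)))) (at ?e)"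
      by (rule has_derivative_add has_derivative_mult has_derivative_mult_right r3 d)+
    moreover have "h $ 3 + (k * ?e $ 3 * ((s^2 / 4 - c3 * s) * (h $ 1 + h $ 2) - c3 * s * h $ 3)
        + k * h $ 3 * ((?e $ 1 + ?e $ 2) / (?e $ 1 + ?e $ 2 + ?e $ 3)\<^sup>2 - c3))
      = (J_E2 c1 c2 c3 k l *v h) $ 3" for h
    proof -
      have 1: "k * ?e $ 3 * (s^2 / 4 - c3 * s) = k * (c1 + c2 - c3) * (1 / 2 - 2 * c3 / s)"
        and 2: "k * ?e $ 3 * (c3 * s) = 2 * k * c3 * (c1 + c2 - c3) / s"
        using \<open>s > 0\<close> by (simp_all add: z field_simps power2_eq_square)
      \<comment> \<open>The literal factor 0 stands for the bracket, so that this matches the goal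
        after unfolding with \<open>g\<close>.\<close>
      have "h $ 3 + (K * ((s^2 / 4 - c3 * s) * H - c3 * s * h $ 3) + k * h $ 3 * 0)
          = K * (s^2 / 4 - c3 * s) * H + (1 - K * (c3 * s)) * h $ 3" for K H
        by (simp add: algebra_simps)
      then show ?thesis
        unfolding g J_E2_mult_nth s_def[symmetric] 1[symmetric] 2[symmetric] .
    qed
    ultimately show ?thesis
      unfolding i T_ANB_nth by simp
  qed
qed

text \<open>The coefficients are minus the trace, the sum of the principal 2 by 2 minors, and minus
  the determinant. In dimension 3, det(J - mu I) is minus the monic characteristic
  polynomial.\<close>

lemma complex_eigenvalue_J_E2:
  fixes c1 c2 c3 k l :: real
  defines "s \<equiv> c1 + c2 + c3"
  defines "a \<equiv> s / (4 * c1) - 1"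
    and "b \<equiv> s / (4 * c2) - 1"
    and "p \<equiv> k * (c1 + c2 - c3) * (1 / 2 - 2 * c3 / s)"
    and "q \<equiv> 1 - 2 * k * c3 * (c1 + c2 - c3) / s"
  shows "complex_eigenvalue (J_E2 c1 c2 c3 k l) \<mu> \<longleftrightarrow>
    \<mu>^3 + of_real (- (1 - l + q)) * \<mu>^2
      + of_real ((1 - l) * q - l * a * b - l * a * p - b * p) * \<mu>
      + of_real ((1 - l) * b * p + l * a * b * q - 2 * l * a * b * p) = 0"
proof -
  have J: "J_E2 c1 c2 c3 k l = vector [vector [1 - l, l * a, l * a], vector [b, 0, b], vector [p, p, q]]"
    by (simp only: J_E2_def Let_def a_def b_def p_def q_def s_def)
  have "det (map_matrix complex_of_real (J_E2 c1 c2 c3 k l) - mat \<mu>) = - (\<mu>^3 + of_real (- (1 - l + q)) * \<mu>^2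
      + of_real ((1 - l) * q - l * a * b - l * a * p - b * p) * \<mu>
      + of_real ((1 - l) * b * p + l * a * b * q - 2 * l * a * b * p))"
    by (simp add: J det_3 mat_def power2_eq_square power3_eq_cube algebra_simps)
  then show ?thesis
    by (simp only: complex_eigenvalue_iff_det neg_equal_0_iff_equal)
qed

lemma strictly_positive_E2:
  assumes "c1 + c2 + c3 > 0"
  shows "strictly_positive (E2 c1 c2 c3) \<longleftrightarrow> c1 < c2 + c3 \<and> c2 < c1 + c3 \<and> c3 < c1 + c2"
  using assms
  by (auto simp: strictly_positive_def forall_3 E2_def zero_less_divide_iff zero_less_mult_iff)

lemma locally_stable_E2:
  fixes c1 c2 c3 k l :: real
  defines "s \<equiv> c1 + c2 + c3"
  defines "a \<equiv> s / (4 * c1) - 1"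
    and "b \<equiv> s / (4 * c2) - 1"
    and "p \<equiv> k * (c1 + c2 - c3) * (1 / 2 - 2 * c3 / s)"
    and "q \<equiv> 1 - 2 * k * c3 * (c1 + c2 - c3) / s"
  defines "A \<equiv> - (1 - l + q)"
    and "B \<equiv> (1 - l) * q - l * a * b - l * a * p - b * p"
    and "C \<equiv> (1 - l) * b * p + l * a * b * q - 2 * l * a * b * p"
  assumes "c1 > 0" "c2 > 0" "c3 > 0"
  shows "locally_stable (T_ANB c1 c2 c3 k l) (E2 c1 c2 c3) \<longleftrightarrow>
    1 + A + B + C > 0 \<and> 1 - A + B - C > 0 \<and> 1 - B + A * C - C^2 > 0 \<and> \<bar>C\<bar> < 1"
proof -
  let ?f = "T_ANB c1 c2 c3 k l" and ?p = "E2 c1 c2 c3"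
  note der = T_ANB_has_derivative_E2[OF assms(9-11), of k l]
  have "jacobian ?f (at ?p) = J_E2 c1 c2 c3 k l"
    unfolding jacobian_def frechet_derivative_at[OF der, symmetric] by simp
  then have "locally_stable ?f ?p \<longleftrightarrow> (\<forall>\<mu>. complex_eigenvalue (J_E2 c1 c2 c3 k l) \<mu> \<longrightarrow> norm \<mu> < 1)"
    using der by (auto simp: locally_stable_def differentiable_def)
  then show ?thesis
    unfolding complex_eigenvalue_J_E2 A_def B_def C_def a_def b_def p_def q_def s_def
    by (simp only: cubic_roots_in_disc)
qed

section \<open>From the Schur-Cohn conditions to the \<open>LS\<close> inequalities\<close>

lemma Jury_constant_term_lower_bound:
  fixes A B C :: real
  assumes "1 - A + B - C > 0" "1 + A + B + C > 0" "1 - B + A * C - C^2 > 0" "A > - 3"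
  shows "C > - 1"
proof (rule ccontr)
  assume "\<not> C > - 1"
  \<comment> \<open>The second factor is nonnegative by \<open>- C \<ge> 1\<close> and
    \<open>A > - 3\<close>. Since \<open>B > - (1 + A + C)\<close>, the determinant expression lies
    strictly below this product.\<close>
  then have "(1 + C) * (2 - C + A) \<le> 0"
    using assms by (intro mult_nonpos_nonneg) auto
  with assms show False by (simp add: algebra_simps power2_eq_square)
qed

text \<open>Denominators are cleared here: \<open>P, Q\<close> are \<open>s\<close> times the Jacobian entries \<open>p, q\<close>, and \<open>A, B, C\<close>
  are \<open>s\<close> times the coefficients of the characteristic polynomial. The scaling constants are
  \<open>10\<^sup>4 (8/3) c\<^sub>1 c\<^sub>2\<close>, \<open>10\<^sup>9 8 c\<^sub>1 c\<^sub>2\<close> and \<open>10\<^sup>1\<^sup>8 (4 c\<^sub>1 c\<^sub>2 / 5)\<^sup>2\<close> with \<open>c\<^sub>1 c\<^sub>2 = 3.423\<close>.\<close>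

lemma Jury_expressions_LS:
  fixes c3 k :: real
  assumes s: "s = c3 + 373 / 100" and a: "a = (100 * c3 - 279) / 652" and b: "b = (100 * c3 - 467) / 840"
    and P: "P = k * (373 / 100 - c3) * (s - 4 * c3) / 2" and Q: "Q = s - 2 * k * c3 * (373 / 100 - c3)"
    and A: "A = - (2 / 5 * s + Q)"
    and B: "B = 2 / 5 * Q - 3 / 5 * a * b * s - (3 / 5 * a + b) * P"
    and C: "C = 2 / 5 * b * P + 3 / 5 * a * b * Q - 6 / 5 * a * b * P"
  shows "91280 * (s + A + B + C) = 1000 * k * (373 / 100 - c3) * s^3"
    and "27384000000 * (s - A + B - C) = LS3_ANB c3 k"
    and "7498834560000000000 * (s * s - B * s + A * C - C * C) = - (s * LS4_ANB c3 k)"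
    and "s - C - (s - A + B - C) / 4 = 3 / 10 * (1 - a * b) * s + k * (373 / 100 - c3) *
      (363055447 / 1095360000 + 4936837 / 10953600 * c3 + 2423 / 36512 * c3^2 - 75 / 9128 * c3^3)"
proof -
  show "91280 * (s + A + B + C) = 1000 * k * (373 / 100 - c3) * s^3"
    unfolding A B C P Q a b s by algebra
  show "27384000000 * (s - A + B - C) = LS3_ANB c3 k"
    unfolding A B C P Q a b s LS3_ANB_def by algebra
  show "7498834560000000000 * (s * s - B * s + A * C - C * C) = - (s * LS4_ANB c3 k)"
    unfolding A B C P Q a b s LS4_ANB_def by algebra
  \<comment> \<open>The weight 1/4 is the one for which the part free of \<open>k\<close> is a
    multiple of \<open>1 - a * b\<close>; the rest is linear in \<open>k\<close> and carries the
    factor \<open>373 / 100 - c3\<close>.\<close>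
  show "s - C - (s - A + B - C) / 4 = 3 / 10 * (1 - a * b) * s + k * (373 / 100 - c3) *
      (363055447 / 1095360000 + 4936837 / 10953600 * c3 + 2423 / 36512 * c3^2 - 75 / 9128 * c3^3)"
    unfolding A B C P Q a b s by algebra
qed

theorem theorem1:
  fixes c1 c2 c3 k l :: real
  assumes "c1 = 1.63" and "c2 = 2.1" and "l = 0.6"
    and "c3 > 0" and "k > 0"
  shows "(equilibrium (T_ANB c1 c2 c3 k l) (E2 c1 c2 c3)
          \<and> strictly_positive (E2 c1 c2 c3)
          \<and> locally_stable (T_ANB c1 c2 c3 k l) (E2 c1 c2 c3))
     \<longleftrightarrow> (LS1_ANB c3 > 0 \<and> LS2_ANB c3 < 0 \<and> LS3_ANB c3 k > 0 \<and> LS4_ANB c3 k < 0)"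
proof -
  have pos: "c1 > 0" "c2 > 0" and par: "c1 = 163 / 100" "c2 = 21 / 10" "l = 3 / 5"
    using assms by simp_all
  define s where "s = c1 + c2 + c3"
  define a where "a = s / (4 * c1) - 1"
  define b where "b = s / (4 * c2) - 1"
  define p where "p = k * (c1 + c2 - c3) * (1 / 2 - 2 * c3 / s)"
  define q where "q = 1 - 2 * k * c3 * (c1 + c2 - c3) / s"
  define A where "A = - (1 - l + q)"
  define B where "B = (1 - l) * q - l * a * b - l * a * p - b * p"
  define C where "C = (1 - l) * b * p + l * a * b * q - 2 * l * a * b * p"
  note coeffs = A_def B_def C_def p_def q_def a_def b_def
  have "s > 0" using pos \<open>c3 > 0\<close> by (simp add: s_def)
  have stable: "locally_stable (T_ANB c1 c2 c3 k l) (E2 c1 c2 c3) \<longleftrightarrow>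
    1 + A + B + C > 0 \<and> 1 - A + B - C > 0 \<and> 1 - B + A * C - C^2 > 0 \<and> \<bar>C\<bar> < 1"
    unfolding coeffs s_def using pos \<open>c3 > 0\<close> by (rule locally_stable_E2)
  \<comment> \<open>Positivity of the first coordinate is automatic because \<open>c1 < c2\<close>;
    the other two give the bounds \<open>c3 > 47 / 100\<close> and
    \<open>c3 < 373 / 100\<close>.\<close>
  have positive: "strictly_positive (E2 c1 c2 c3) \<longleftrightarrow> LS1_ANB c3 > 0 \<and> LS2_ANB c3 < 0"
    using \<open>s > 0\<close> \<open>c3 > 0\<close> unfolding s_def
    by (subst strictly_positive_E2) (auto simp: par LS1_ANB_def LS2_ANB_def)
  have ab: "s = c3 + 373 / 100" "a = (100 * c3 - 279) / 652" "b = (100 * c3 - 467) / 840"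
    by (simp_all add: a_def b_def s_def par field_simps)
  have pq: "s * p = k * (373 / 100 - c3) * (s - 4 * c3) / 2"
    "s * q = s - 2 * k * c3 * (373 / 100 - c3)"
    using \<open>s > 0\<close> by (simp_all add: p_def q_def par field_simps)
  have ABC: "s * A = - (2 / 5 * s + s * q)"
    "s * B = 2 / 5 * (s * q) - 3 / 5 * a * b * s - (3 / 5 * a + b) * (s * p)"
    "s * C = 2 / 5 * b * (s * p) + 3 / 5 * a * b * (s * q) - 6 / 5 * a * b * (s * p)"
    by (simp_all add: A_def B_def C_def par algebra_simps)
  note LS = Jury_expressions_LS[OF ab pq ABC]
  have P: "91280 * s * (1 + A + B + C) = 1000 * k * (373 / 100 - c3) * s^3"
    using LS(1) by (simp add: algebra_simps)
  have M: "27384000000 * s * (1 - A + B - C) = LS3_ANB c3 k"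
    using LS(2) by (simp add: algebra_simps)
  \<comment> \<open>In the scaled coefficients the determinant expression carries
    \<open>s^2\<close>, while the right-hand side carries only one \<open>s\<close>, so one factor
    cancels.\<close>
  have "s * (7498834560000000000 * s * (1 - B + A * C - C^2)) = s * (- LS4_ANB c3 k)"
    using LS(3) by (simp add: algebra_simps power2_eq_square)
  then have D: "7498834560000000000 * s * (1 - B + A * C - C^2) = - LS4_ANB c3 k"
    using \<open>s > 0\<close> by (simp only: mult_cancel_left) simp
  have bound: "\<bar>C\<bar> < 1" if "47 / 100 < c3" "c3 < 373 / 100"
    "1 + A + B + C > 0" "1 - A + B - C > 0" "1 - B + A * C - C^2 > 0"
  proof -
    have "s * (1 - C - (1 - A + B - C) / 4) = 3 / 10 * (1 - a * b) * s + k * (373 / 100 - c3) *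
        (363055447 / 1095360000 + 4936837 / 10953600 * c3 + 2423 / 36512 * c3^2 - 75 / 9128 * c3^3)"
      unfolding LS(4)[symmetric] by (simp add: algebra_simps)
    also have "\<dots> > 0"
    proof -
      have "\<bar>a\<bar> \<le> 1" "\<bar>b\<bar> < 1"
        unfolding ab(2,3) using that(1,2) by (simp_all add: abs_le_iff abs_less_iff)
      then have "\<bar>a\<bar> * \<bar>b\<bar> < 1"
        by (metis abs_ge_zero le_less_trans mult_left_le_one_le)
      then have "a * b < 1"
        by (metis abs_ge_self abs_mult le_less_trans)
      then have "3 / 10 * (1 - a * b) * s > 0"
        using \<open>s > 0\<close> by simp
      \<comment> \<open>Only the cubic coefficient is negative. By \<open>c3 < 373 / 100\<close> its
        term is at most \<open>1119 / 36512 * c3^2\<close>, which the quadratic term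
        absorbs.\<close>
      moreover have "c3^3 \<le> 373 / 100 * c3^2"
        using that(2) mult_right_mono[of c3 "373 / 100" "c3^2"]
        by (simp add: power2_eq_square power3_eq_cube)
      then have "75 / 9128 * c3^3 \<le> 2423 / 36512 * c3^2"
        using zero_le_power2[of c3] by linarith
      then have "k * (373 / 100 - c3) *
          (363055447 / 1095360000 + 4936837 / 10953600 * c3 + 2423 / 36512 * c3^2 - 75 / 9128 * c3^3) > 0"
        using that(2) \<open>c3 > 0\<close> \<open>k > 0\<close> by (intro mult_pos_pos) auto
      ultimately show ?thesis
        by (rule add_pos_pos)
    qed
    finally have "C < 1"
      using that(4) \<open>s > 0\<close> by (simp add: zero_less_mult_iff)
    \<comment> \<open>This quantity is \<open>1 - q\<close>, so \<open>q < 1\<close> and in fact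
      \<open>A > - 7 / 5\<close>.\<close>
    moreover have "2 * k * c3 * (c1 + c2 - c3) / s > 0"
      using that(2) \<open>s > 0\<close> \<open>c3 > 0\<close> \<open>k > 0\<close> by (auto simp: par)
    then have "A > - 3" by (simp add: A_def q_def par)
    with that have "C > - 1" using Jury_constant_term_lower_bound by blast
    ultimately show ?thesis by simp
  qed
  have Ppos: "1 + A + B + C > 0" if "c3 < 373 / 100"
  proof -
    have "91280 * s * (1 + A + B + C) > 0"
      unfolding P using that \<open>s > 0\<close> \<open>k > 0\<close> by simp
    then show ?thesis
      using \<open>s > 0\<close> by (simp add: zero_less_mult_iff)
  qed
  have M': "1 - A + B - C > 0 \<longleftrightarrow> LS3_ANB c3 k > 0"
    unfolding M[symmetric] using \<open>s > 0\<close> by (simp add: zero_less_mult_iff)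
  have "0 < 7498834560000000000 * s * (1 - B + A * C - C^2) \<longleftrightarrow> 0 < 1 - B + A * C - C^2"
    using \<open>s > 0\<close> by (simp only: zero_less_mult_iff) simp
  then have D': "1 - B + A * C - C^2 > 0 \<longleftrightarrow> LS4_ANB c3 k < 0"
    unfolding D by simp
  show ?thesis
  proof (cases "LS1_ANB c3 > 0 \<and> LS2_ANB c3 < 0")
    case True
    then have "47 / 100 < c3" "c3 < 373 / 100"
      by (simp_all add: LS1_ANB_def LS2_ANB_def)
    then show ?thesis
      using positive stable bound Ppos M' D' equilibrium_E2[OF pos \<open>c3 > 0\<close>] by blast
  qed (use positive in blast)
qed

end
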